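(* Let $\kappa>0$, let $\lambda\in[0,1]$, and set $a_n=b_n=n^{\lambda}$ for $n\ge 1$. Let $(f,(c_n)_{n\ge1})$ be the solution of the system $$\partial_t c_n=J_{n-1}-J_n\ (n\ge1),\qquad \partial_t f=-\sum_{n=0}^\infty J_n,$$ $$J_n=\kappa a_n f c_n-b_{n+1}c_{n+1}\ (n\ge1),\qquad J_0=-c_1,$$ with nonnegative initial data of finite mass $\rho=f(0)+\sum_{n=1}^\infty n c_n(0)<\infty$, and assume $f(0)<\rho$. 1. Then $c_n(t)\to0$ as $t\to\infty$ for all $n\ge1$. 2. Suppose that $\sum_{n=1}^\infty n^{2-\lambda}c_n(0)<\infty$. Then $f(t)\to\min\left(\rho,\frac1\kappa\right)$ as $t\to\infty$.
   Context: A solution is a family of nonnegative functions $f,c_n:[0,\infty)\to[0,\infty)$ ($n\ge1$), continuously differentiable, satisfying the stated differential equations for all $t\ge 0$ with the prescribed initial data, and conserving mass: $f(t)+\sum_{n=1}^\infty n c_n(t)=\rho$ for all $t\ge0$. Well-posedness of the system for coefficients $0<a_n,b_n=O(n)$ and nonnegative initial data of finite mass $\rho$ is taken as known. *)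

theory Defs
  imports Complex_Main
begin

text \<open>
  Clusters of size \<open>n \<ge> 1\<close> have concentration \<open>c n\<close>; the value \<open>c 0\<close> carries no meaning and
  is never constrained. In the sums below that run over all \<open>n :: nat\<close> with weight \<open>real n\<close>
  or \<open>real n powr s\<close>, the term for \<open>n = 0\<close> is zero (note \<open>0 powr s = 0\<close> for every \<open>s\<close>).
\<close>

definition flux ::
  "real \<Rightarrow> (nat \<Rightarrow> real) \<Rightarrow> (nat \<Rightarrow> real) \<Rightarrow> (real \<Rightarrow> real) \<Rightarrow> (nat \<Rightarrow> real \<Rightarrow> real)
    \<Rightarrow> nat \<Rightarrow> real \<Rightarrow> real" where
  "flux \<kappa> a b f c n t =
     (if n = 0 then - c 1 t
      else \<kappa> * a n * f t * c n t - b (n + 1) * c (n + 1) t)"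

text \<open>The derivative at \<open>0\<close> is one-sided; values at negative times are irrelevant.\<close>

definition has_C1_derivative :: "(real \<Rightarrow> real) \<Rightarrow> (real \<Rightarrow> real) \<Rightarrow> bool" where
  "has_C1_derivative g g' \<longleftrightarrow>
     (\<forall>t\<ge>0. (g has_real_derivative g' t) (at t within {0..})) \<and> continuous_on {0..} g'"

definition is_solution ::
  "real \<Rightarrow> (nat \<Rightarrow> real) \<Rightarrow> (nat \<Rightarrow> real) \<Rightarrow> real
    \<Rightarrow> (real \<Rightarrow> real) \<Rightarrow> (nat \<Rightarrow> real \<Rightarrow> real) \<Rightarrow> bool" where
  "is_solution \<kappa> a b \<rho> f c \<longleftrightarrow>
     (\<forall>t\<ge>0. f t \<ge> 0) \<and>
     (\<forall>n\<ge>1. \<forall>t\<ge>0. c n t \<ge> 0) \<and>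
     (\<forall>n\<ge>1. has_C1_derivative (c n) (\<lambda>t. flux \<kappa> a b f c (n - 1) t - flux \<kappa> a b f c n t)) \<and>
     (\<forall>t\<ge>0. summable (\<lambda>n. flux \<kappa> a b f c n t)) \<and>
     has_C1_derivative f (\<lambda>t. - (\<Sum>n. flux \<kappa> a b f c n t)) \<and>
     (\<forall>t\<ge>0. summable (\<lambda>n. real n * c n t) \<and> f t + (\<Sum>n. real n * c n t) = \<rho>)"

end

theory Submission
  imports Defs "HOL-Analysis.Convex"
begin

text \<open>
  Write \<open>d n = n powr lam * c n\<close> and \<open>S = (\<Sum>n. d n)\<close>, called \<open>rate\<close> and \<open>total_rate\<close> below.
  The coefficients of growth and dissolution are the same powers of \<open>n\<close>, so
  \<open>J n = \<kappa> f d n - d (n + 1)\<close> for all \<open>n \<ge> 0\<close>, and summing these fluxes gives the scalar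
  equation \<open>f' = (1 - \<kappa> f) S\<close>. Hence \<open>1 - \<kappa> f\<close> keeps its sign and never grows in modulus, and \<open>f\<close> is monotone.

  Infinite sums of the \<open>c n\<close> are not known to be differentiable, so every balance law is derived
  for finite sums with weights \<open>w n\<close> of bounded support. If \<open>w\<close> has increments of size
  \<open>B n powr (1 - lam)\<close>, the flux through size \<open>n\<close> contributes at most a multiple of
  \<open>n c n\<close> and \<open>(n + 1) c (n + 1)\<close>, so the mass controls the growth of the weighted sum
  (\<open>weighted_sum_growth\<close>). The weights \<open>1\<close> and \<open>n powr (2 - lam)\<close> keep increments of this size,
  uniformly in \<open>K\<close>, when multiplied by the linear cutoff \<open>max 0 (1 - n / K)\<close>; then \<open>K\<close> is
  sent to infinity.

  The cutoff alone, for which \<open>B = 1 / K\<close>, yields that the number of clusters falls at least as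
  fast as clusters of size one dissolve (\<open>cluster_number_decrease\<close>). This number is nonnegative and
  nonincreasing, hence converges; as \<open>c 1\<close> is Lipschitz, this forces \<open>c 1\<close> to tend to zero. From
  there the argument climbs: if \<open>d n\<close> tends to zero, then so does \<open>c n\<close>, while its derivative is
  at least \<open>d (n + 1)\<close> up to a term that tends to zero, and \<open>d (n + 1)\<close> must tend to zero as
  well (\<open>rate_Suc_tendsto_0\<close>).

  The weight \<open>n powr (2 - lam)\<close> shows that the corresponding moment, if finite initially, grows at
  most linearly in time (\<open>moment_growth\<close>). The cluster mass \<open>\<rho> - f\<close> is the first moment, and
  Cauchy-Schwarz between the exponents \<open>lam\<close> and \<open>2 - lam\<close> gives
  \<open>(\<rho> - f)\<^sup>2 \<le> S (A + B t)\<close>. While the cluster mass stays above a positive constant,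
  \<open>S\<close> is therefore at least of order \<open>1 / t\<close>, which is not integrable, and
  \<open>1 - \<kappa> f\<close> decays to \<open>0\<close> (\<open>excess_decays\<close>). The only alternative is that the cluster mass
  vanishes, which happens only for increasing \<open>f\<close> and then gives the limit \<open>\<rho> \<le> 1 / \<kappa>\<close>.
\<close>

section \<open>Calculus on the half-line\<close>

lemma half_line_continuous_on:
  fixes g g' :: "real \<Rightarrow> real"
  assumes "\<And>t. t \<ge> 0 \<Longrightarrow> (g has_real_derivative g' t) (at t within {0..})"
    and "0 \<le> s"
  shows "continuous_on {s..t} g"
proof (rule DERIV_continuous_on)
  fix x assume "x \<in> {s..t}"
  then show "(g has_real_derivative g' x) (at x within {s..t})"
    using assms by (intro DERIV_subset[OF assms(1)]) auto
qed

lemma half_line_mvt: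
  fixes g g' :: "real \<Rightarrow> real"
  assumes deriv: "\<And>t. t \<ge> 0 \<Longrightarrow> (g has_real_derivative g' t) (at t within {0..})"
    and st: "0 \<le> s" "s < t"
  obtains x where "s < x" "x < t" "g t - g s = (t - s) * g' x"
proof -
  note cont = half_line_continuous_on[OF deriv st(1), of t]
  have d: "(g has_real_derivative g' x) (at x)" if "s < x" for x
  proof -
    have "at x within {0..} = at x"
      using that st by (intro at_within_nhd[of x "{0<..}"]) auto
    then show ?thesis using deriv[of x] that st by simp
  qed
  obtain l z where "s < z" "z < t" "DERIV g z :> l" "g t - g s = (t - s) * l"
    using MVT[OF st(2) cont] d real_differentiable_def by metis
  moreover from this have "l = g' z" using d DERIV_unique by blast
  ultimately show ?thesis using that by blast
qed

lemma half_line_antimono: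
  fixes g g' :: "real \<Rightarrow> real"
  assumes "\<And>t. t \<ge> 0 \<Longrightarrow> (g has_real_derivative g' t) (at t within {0..})"
    and "\<And>t. t \<ge> 0 \<Longrightarrow> g' t \<le> 0"
    and "0 \<le> s" "s \<le> t"
  shows "g t \<le> g s"
proof (cases "s = t")
  case False
  with assms(4) have "s < t" by simp
  then obtain x where "s < x" "g t - g s = (t - s) * g' x"
    using half_line_mvt[OF assms(1) assms(3)] by blast
  moreover have "(t - s) * g' x \<le> 0"
    using assms(2)[of x] \<open>s < x\<close> assms(3,4) by (intro mult_nonneg_nonpos) auto
  ultimately show ?thesis by simp
qed simp

lemma half_line_lipschitz:
  fixes g g' :: "real \<Rightarrow> real"
  assumes "\<And>t. t \<ge> 0 \<Longrightarrow> (g has_real_derivative g' t) (at t within {0..})"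
    and "\<And>t. t \<ge> 0 \<Longrightarrow> \<bar>g' t\<bar> \<le> L"
    and "0 \<le> s" "s \<le> t"
  shows "\<bar>g t - g s\<bar> \<le> L * (t - s)"
proof (cases "s = t")
  case False
  with assms(4) have "s < t" by simp
  then obtain x where "s < x" "g t - g s = (t - s) * g' x"
    using half_line_mvt[OF assms(1) assms(3)] by blast
  moreover have "(t - s) * \<bar>g' x\<bar> \<le> (t - s) * L"
    using assms(2)[of x] \<open>s < x\<close> assms(3,4) by (intro mult_left_mono) auto
  ultimately show ?thesis using assms(4) by (simp add: abs_mult mult.commute)
qed simp

lemma antimono_bounded_below_converges:
  fixes g :: "real \<Rightarrow> real"
  assumes anti: "\<And>s t. 0 \<le> s \<Longrightarrow> s \<le> t \<Longrightarrow> g t \<le> g s"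
    and lower: "\<And>t. 0 \<le> t \<Longrightarrow> m \<le> g t"
  shows "\<exists>l. (g \<longlongrightarrow> l) at_top"
proof -
  let ?l = "Inf (g ` {0..})"
  have bdd: "bdd_below (g ` {0..})" using lower by (auto intro!: bdd_belowI[of _ m])
  have "(g \<longlongrightarrow> ?l) at_top"
  proof (rule decreasing_tendsto)
    show "\<forall>\<^sub>F t in at_top. ?l \<le> g t"
      using eventually_ge_at_top[of 0] by eventually_elim (auto intro!: cInf_lower bdd)
    fix x assume "?l < x"
    then obtain s where s: "0 \<le> s" "g s < x" using cInf_lessD[of "g ` {0..}" x] by auto
    show "\<forall>\<^sub>F t in at_top. g t < x"
      using eventually_ge_at_top[of s]
    proof eventually_elim
      case (elim t)
      with s show ?case using anti[of s t] by linarith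
    qed
  qed
  then show ?thesis ..
qed

text \<open>
  A variant of Barbalat's lemma. The hypothesis \<open>incr\<close> says that over a short time \<open>h\<close> a value of
  \<open>p\<close> accounts for an increment of \<open>G\<close> of size about \<open>h * p t\<close>, up to an error \<open>L * h\<close> from the
  oscillation of \<open>p\<close> and a vanishing error \<open>e\<close>. It avoids asking for a derivative of \<open>G\<close>,
  so it also covers the total number of clusters.
\<close>

lemma vanishing_from_increments:
  fixes G p :: "real \<Rightarrow> real"
  assumes lim: "(G \<longlongrightarrow> l) at_top"
    and nonneg: "\<And>t. 0 \<le> t \<Longrightarrow> 0 \<le> p t"
    and L: "0 \<le> L"
    and incr: "\<And>h e. 0 < h \<Longrightarrow> 0 < e \<Longrightarrow>
      \<forall>\<^sub>F t in at_top. h * p t \<le> \<bar>G (t + h) - G t\<bar> + h * (L * h + e)"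
  shows "(p \<longlongrightarrow> 0) at_top"
proof (rule order_tendstoI)
  fix x :: real assume x: "x < 0"
  show "\<forall>\<^sub>F t in at_top. x < p t"
    using eventually_ge_at_top[of 0]
  proof eventually_elim
    case (elim t)
    with x show ?case using nonneg[of t] by linarith
  qed
next
  fix x :: real assume x: "0 < x"
  \<comment> \<open>A quarter of \<open>x\<close> is granted to each of \<open>L * h\<close>, \<open>e\<close> and the increment of \<open>G\<close> per unit time.\<close>
  define h where "h = x / (4 * (L + 1))"
  have h: "0 < h" "L * h \<le> x / 4"
    using x L by (auto simp: h_def field_simps)
  have "((\<lambda>t. G (t + h)) \<longlongrightarrow> l) at_top"
    by (rule filterlim_compose[OF lim]) (rule filterlim_at_top_mono[OF filterlim_ident], use h in auto)
  from tendsto_rabs[OF tendsto_diff[OF this lim]]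
  have "((\<lambda>t. \<bar>G (t + h) - G t\<bar>) \<longlongrightarrow> 0) at_top" by simp
  then have "\<forall>\<^sub>F t in at_top. \<bar>G (t + h) - G t\<bar> < h * (x / 4)"
    using h x by (intro order_tendstoD) auto
  moreover have "\<forall>\<^sub>F t in at_top. h * p t \<le> \<bar>G (t + h) - G t\<bar> + h * (L * h + x / 4)"
    using incr h x by simp
  ultimately show "\<forall>\<^sub>F t in at_top. p t < x"
  proof eventually_elim
    case (elim t)
    have "h * (L * h + x / 4) \<le> h * (x / 4 + x / 4)"
      using h by (intro mult_left_mono) auto
    with elim have "h * p t < h * (x / 4) + h * (x / 4 + x / 4)" by linarith
    also have "\<dots> = h * (3 / 4 * x)" by (simp add: algebra_simps)
    also have "\<dots> < h * x" using h x by (intro mult_strict_left_mono) auto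
    finally show ?case using h by simp
  qed
qed

section \<open>Linear equations with nonnegative damping\<close>

text \<open>
  A sign change would pass through a zero of \<open>g\<close>; since \<open>g\<^sup>2\<close> is nonincreasing, \<open>g\<close> would stay
  zero afterwards. No integral of the damping rate \<open>h\<close> is formed, so \<open>h\<close> may be any nonnegative
  function.
\<close>

lemma damped_sign:
  fixes g h :: "real \<Rightarrow> real"
  assumes deriv: "\<And>t. t \<ge> 0 \<Longrightarrow> (g has_real_derivative - h t * g t) (at t within {0..})"
    and h: "\<And>t. t \<ge> 0 \<Longrightarrow> 0 \<le> h t"
    and "0 \<le> g 0" "0 \<le> t"
  shows "0 \<le> g t"
proof (rule ccontr)
  assume neg: "\<not> 0 \<le> g t"
  have "continuous_on {0..t} g"
    by (rule half_line_continuous_on[OF deriv order_refl])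
  then obtain s where s: "0 \<le> s" "s \<le> t" "g s = 0"
    using IVT2'[of g t 0 0] assms neg by auto
  have "(g t)\<^sup>2 \<le> (g s)\<^sup>2"
  proof (rule half_line_antimono[OF _ _ s(1,2)])
    fix u :: real assume u: "0 \<le> u"
    show "((\<lambda>u. (g u)\<^sup>2) has_real_derivative - 2 * h u * (g u)\<^sup>2) (at u within {0..})"
      by (rule derivative_eq_intros deriv u)+ (simp add: power2_eq_square)
    show "- 2 * h u * (g u)\<^sup>2 \<le> 0" using h[OF u] by simp
  qed
  then show False using s neg by simp
qed

lemma damped_antimono:
  fixes g h :: "real \<Rightarrow> real"
  assumes deriv: "\<And>t. t \<ge> 0 \<Longrightarrow> (g has_real_derivative - h t * g t) (at t within {0..})"
    and h: "\<And>t. t \<ge> 0 \<Longrightarrow> 0 \<le> h t"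
    and "0 \<le> g 0" "0 \<le> s" "s \<le> t"
  shows "g t \<le> g s"
proof (rule half_line_antimono[OF deriv _ \<open>0 \<le> s\<close> \<open>s \<le> t\<close>])
  fix u :: real assume "0 \<le> u"
  then show "- h u * g u \<le> 0" using h damped_sign[OF deriv h \<open>0 \<le> g 0\<close>] by simp
qed

text \<open>
  A damping rate of order \<open>1 / t\<close> has infinite integral. Concretely \<open>g t * (A + B * t) powr (q / B)\<close>
  is nonincreasing, because the exponent balances the smallest damping that \<open>h\<close> allows, and
  thus \<open>g\<close> decays like a negative power of time.
\<close>

lemma damped_decay:
  fixes g h :: "real \<Rightarrow> real"
  assumes deriv: "\<And>t. t \<ge> 0 \<Longrightarrow> (g has_real_derivative - h t * g t) (at t within {0..})"
    and pos: "0 < q" "0 < A" "0 < B"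
    and h: "\<And>t. t \<ge> 0 \<Longrightarrow> q \<le> h t * (A + B * t)"
    and g0: "0 \<le> g 0"
  shows "(g \<longlongrightarrow> 0) at_top"
proof -
  have affine_pos: "0 < A + B * t" if "0 \<le> t" for t using pos that by (simp add: add_pos_nonneg)
  have h_nonneg: "0 \<le> h t" if "0 \<le> t" for t
  proof -
    have "0 < h t * (A + B * t)" using h[OF that] pos by linarith
    then show ?thesis using affine_pos[OF that] by (simp add: zero_less_mult_iff)
  qed
  define \<alpha> where "\<alpha> = q / B"
  have \<alpha>: "0 < \<alpha>" "\<alpha> * B = q" using pos by (auto simp: \<alpha>_def)
  have bound: "g t \<le> g 0 * A powr \<alpha> * (A + B * t) powr (- \<alpha>)" if "0 \<le> t" for t
  proof -
    have "g t * (A + B * t) powr \<alpha> \<le> g 0 * (A + B * 0) powr \<alpha>"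
    proof (rule half_line_antimono[OF _ _ order_refl that])
      fix u :: real assume u: "0 \<le> u"
      note p = affine_pos[OF u]
      show "((\<lambda>t. g t * (A + B * t) powr \<alpha>) has_real_derivative
          g u * (A + B * u) powr (\<alpha> - 1) * (q - h u * (A + B * u))) (at u within {0..})"
      proof -
        have lin: "((\<lambda>t. A + B * t) has_real_derivative B) (at u within {0..})"
          by (auto intro!: derivative_eq_intros)
        have "((\<lambda>t. (A + B * t) powr \<alpha>) has_real_derivative
            \<alpha> * (A + B * u) powr (\<alpha> - 1) * B) (at u within {0..})"
          by (rule DERIV_chain2[where g = "\<lambda>t. A + B * t", OF has_real_derivative_powr[OF p] lin])
        from DERIV_mult[OF deriv[OF u] this]
        have "((\<lambda>t. g t * (A + B * t) powr \<alpha>) has_real_derivative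
            - h u * g u * (A + B * u) powr \<alpha> + \<alpha> * (A + B * u) powr (\<alpha> - 1) * B * g u)
            (at u within {0..})" .
        moreover have "(A + B * u) powr \<alpha> = (A + B * u) powr (\<alpha> - 1) * (A + B * u)"
          using p powr_add[of "A + B * u" "\<alpha> - 1" 1] by simp
        ultimately show ?thesis
          unfolding \<alpha>(2)[symmetric] by (simp add: algebra_simps)
      qed
      show "g u * (A + B * u) powr (\<alpha> - 1) * (q - h u * (A + B * u)) \<le> 0"
        using h[OF u] damped_sign[OF deriv h_nonneg g0 u] by (intro mult_nonneg_nonpos) auto
    qed
    then show ?thesis using affine_pos[OF that] by (simp add: powr_minus field_simps)
  qed
  have "filterlim (\<lambda>t. A + B * t) at_top at_top"
    by (intro filterlim_tendsto_add_at_top[OF tendsto_const]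
        filterlim_tendsto_pos_mult_at_top[OF tendsto_const pos(3) filterlim_ident])
  then have "((\<lambda>t. (A + B * t) powr (- \<alpha>)) \<longlongrightarrow> 0) at_top"
    using \<alpha> by (intro tendsto_neg_powr) auto
  from tendsto_mult_right_zero[OF this]
  have lim: "((\<lambda>t. g 0 * A powr \<alpha> * (A + B * t) powr (- \<alpha>)) \<longlongrightarrow> 0) at_top" .
  show ?thesis
  proof (rule tendsto_sandwich[OF _ _ tendsto_const lim])
    show "\<forall>\<^sub>F t in at_top. 0 \<le> g t"
      by (rule eventually_mono[OF eventually_ge_at_top[of 0] damped_sign[OF deriv h_nonneg g0]])
    show "\<forall>\<^sub>F t in at_top. g t \<le> g 0 * A powr \<alpha> * (A + B * t) powr - \<alpha>"
      by (rule eventually_mono[OF eventually_ge_at_top[of 0] bound])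
  qed
qed

section \<open>Weighted sums of the concentrations\<close>

lemma summation_by_parts:
  fixes w J :: "nat \<Rightarrow> real"
  shows "(\<Sum>n=1..K. w n * (J (n - 1) - J n)) =
    w 1 * J 0 + (\<Sum>n=1..K. (w (Suc n) - w n) * J n) - w (Suc K) * J K"
  by (induction K) (simp_all add: algebra_simps)

text \<open>
  A linear rather than a sharp cutoff: its increments are of size \<open>1 / K\<close>, so it replaces the
  single boundary flux at \<open>K\<close> by an average of fluxes, and the mass controls this average for
  every exponent \<open>lam \<le> 1\<close>.
\<close>

definition cutoff :: "nat \<Rightarrow> nat \<Rightarrow> real" where
  "cutoff K n = max 0 (1 - real n / real K)"

lemma cutoff_bounds: "0 \<le> cutoff K n" "cutoff K n \<le> 1"
  by (auto simp: cutoff_def)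

lemma cutoff_step: "\<bar>cutoff K (Suc n) - cutoff K n\<bar> \<le> 1 / real K"
proof -
  have "real (Suc n) / real K = real n / real K + 1 / real K" "0 \<le> 1 / real K"
    by (simp_all add: add_divide_distrib)
  then show ?thesis unfolding cutoff_def by linarith
qed

lemma cutoff_eq_0: "0 < K \<Longrightarrow> K \<le> n \<Longrightarrow> cutoff K n = 0"
  by (simp add: cutoff_def)

lemma cutoff_below: "0 < K \<Longrightarrow> n \<le> K \<Longrightarrow> cutoff K n = 1 - real n / real K"
  by (simp add: cutoff_def)

text \<open>
  As \<open>1 - lam \<le> 1\<close>, the inequality \<open>(1 + 1 / n) powr (1 - lam) \<le> 1 + 1 / n\<close> reduces the
  claim to a quadratic polynomial.
\<close>

lemma powr_step:
  assumes "0 \<le> lam" "lam \<le> 1" "1 \<le> n"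
  shows "\<bar>real (Suc n) powr (2 - lam) - real n powr (2 - lam)\<bar> \<le> 3 * real n powr (1 - lam)"
proof -
  define x where "x = real n"
  have x: "1 \<le> x" using assms by (simp add: x_def)
  have split: "y powr (2 - lam) = y * y powr (1 - lam)" if "1 \<le> y" for y :: real
    using that powr_add[of y 1 "1 - lam"] by simp
  have "(1 + 1 / x) powr (1 - lam) \<le> (1 + 1 / x) powr 1"
    using x assms by (intro powr_mono) auto
  moreover have "x + 1 = x * (1 + 1 / x)" using x by (simp add: field_simps)
  ultimately have "(x + 1) powr (1 - lam) \<le> x powr (1 - lam) * (1 + 1 / x)"
    using x by (simp add: powr_mult mult_left_mono)
  then have "(x + 1) * (x + 1) powr (1 - lam) \<le> (x + 1) * (x powr (1 - lam) * (1 + 1 / x))"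
    using x by (intro mult_left_mono) auto
  also have "\<dots> = x powr (1 - lam) * (x + 2 + 1 / x)"
    using x by (simp add: field_simps power2_eq_square)
  also have "\<dots> \<le> x powr (1 - lam) * (x + 3)"
    using x by (intro mult_left_mono) auto
  finally have "(x + 1) powr (2 - lam) - x powr (2 - lam) \<le> 3 * x powr (1 - lam)"
    using x by (simp add: split algebra_simps)
  moreover have "x powr (2 - lam) \<le> (x + 1) powr (2 - lam)"
    using x assms by (intro powr_mono2) auto
  ultimately show ?thesis by (simp add: x_def add.commute)
qed

text \<open>
  Truncation adds only one more unit to the constant, since where the cutoff varies, \<open>n \<le> K\<close>, its
  slope \<open>1 / K\<close> is at most \<open>1 / n\<close>. The bound is therefore uniform in \<open>K\<close>.
\<close>

lemma truncated_power_step: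
  assumes "0 \<le> lam" "lam \<le> 1" "1 \<le> n" "0 < K"
  shows "\<bar>real (Suc n) powr (2 - lam) * cutoff K (Suc n) - real n powr (2 - lam) * cutoff K n\<bar>
    \<le> 4 * real n powr (1 - lam)"
proof -
  let ?p = "\<lambda>k. real k powr (2 - lam)"
  have p: "?p n = real n * real n powr (1 - lam)"
    using assms powr_add[of "real n" 1 "1 - lam"] by simp
  have jump: "?p n * \<bar>cutoff K (Suc n) - cutoff K n\<bar> \<le> real n powr (1 - lam)"
  proof (cases "n \<le> K")
    case True
    have "?p n * \<bar>cutoff K (Suc n) - cutoff K n\<bar> \<le> ?p n * (1 / real K)"
      by (intro mult_left_mono cutoff_step) auto
    also have "\<dots> = real n powr (1 - lam) * (real n / real K)" by (simp add: p)
    also have "\<dots> \<le> real n powr (1 - lam) * 1"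
      using True assms by (intro mult_left_mono) auto
    finally show ?thesis by simp
  next
    case False
    then show ?thesis using assms by (simp add: cutoff_eq_0)
  qed
  have "?p (Suc n) * cutoff K (Suc n) - ?p n * cutoff K n =
      (?p (Suc n) - ?p n) * cutoff K (Suc n) + ?p n * (cutoff K (Suc n) - cutoff K n)"
    by (simp add: algebra_simps)
  also have "\<bar>\<dots>\<bar> \<le> \<bar>?p (Suc n) - ?p n\<bar> * 1 + ?p n * \<bar>cutoff K (Suc n) - cutoff K n\<bar>"
  proof (rule order_trans[OF abs_triangle_ineq] add_mono)+
    show "\<bar>(?p (Suc n) - ?p n) * cutoff K (Suc n)\<bar> \<le> \<bar>?p (Suc n) - ?p n\<bar> * 1"
      unfolding abs_mult using cutoff_bounds[of K "Suc n"] by (intro mult_left_mono) auto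
    show "\<bar>?p n * (cutoff K (Suc n) - cutoff K n)\<bar> \<le> ?p n * \<bar>cutoff K (Suc n) - cutoff K n\<bar>"
      by (simp add: abs_mult)
  qed
  also have "\<dots> \<le> 3 * real n powr (1 - lam) * 1 + real n powr (1 - lam)"
    using powr_step[OF assms(1-3)] jump by (intro add_mono) simp_all
  finally show ?thesis by simp
qed

section \<open>A priori estimates\<close>

locale power_law_solution =
  fixes \<kappa> lam \<rho> :: real
    and a b :: "nat \<Rightarrow> real"
    and f :: "real \<Rightarrow> real"
    and c :: "nat \<Rightarrow> real \<Rightarrow> real"
  assumes kappa_pos: "\<kappa> > 0"
    and lam_nonneg: "0 \<le> lam" and lam_le_1: "lam \<le> 1"
    and a_eq: "\<And>n. n \<ge> 1 \<Longrightarrow> a n = real n powr lam"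
    and b_eq: "\<And>n. n \<ge> 1 \<Longrightarrow> b n = real n powr lam"
    and solution: "is_solution \<kappa> a b \<rho> f c"
begin

text \<open>
  Besides \<open>rate n t = b n * c n t\<close>, the dissolution rate of clusters of size \<open>n\<close>, the growth rate is
  \<open>\<kappa> * f t * rate n t\<close>. The value at \<open>n = 0\<close> is \<open>0\<close>, which removes the
  special cases at the smallest size.
\<close>

definition rate :: "nat \<Rightarrow> real \<Rightarrow> real" where
  "rate n t = real n powr lam * c n t"

definition total_rate :: "real \<Rightarrow> real" where
  "total_rate t = (\<Sum>n. rate n t)"

abbreviation J :: "nat \<Rightarrow> real \<Rightarrow> real" where
  "J \<equiv> flux \<kappa> a b f c"

lemma f_nonneg: "0 \<le> t \<Longrightarrow> 0 \<le> f t"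
  using solution unfolding is_solution_def by (elim conjE) simp

lemma c_nonneg: "1 \<le> n \<Longrightarrow> 0 \<le> t \<Longrightarrow> 0 \<le> c n t"
  using solution unfolding is_solution_def by (elim conjE) simp

lemma c_deriv:
  "1 \<le> n \<Longrightarrow> 0 \<le> t \<Longrightarrow> (c n has_real_derivative J (n - 1) t - J n t) (at t within {0..})"
  using solution unfolding is_solution_def has_C1_derivative_def by (elim conjE) simp

lemma f_deriv_flux: "0 \<le> t \<Longrightarrow> (f has_real_derivative - (\<Sum>n. J n t)) (at t within {0..})"
  using solution unfolding is_solution_def has_C1_derivative_def by (elim conjE) simp

lemma summable_mass: "0 \<le> t \<Longrightarrow> summable (\<lambda>n. real n * c n t)"
  using solution unfolding is_solution_def by (elim conjE) simp

lemma mass: "0 \<le> t \<Longrightarrow> (\<Sum>n. real n * c n t) = \<rho> - f t"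
proof -
  assume "0 \<le> t"
  then have "f t + (\<Sum>n. real n * c n t) = \<rho>"
    using solution unfolding is_solution_def by (elim conjE) simp
  then show ?thesis by simp
qed

lemma mass_term_nonneg: "0 \<le> t \<Longrightarrow> 0 \<le> real n * c n t"
  using c_nonneg[of n t] by (cases n) auto

lemma partial_mass_le:
  assumes "0 \<le> t" "finite A"
  shows "(\<Sum>n\<in>A. real n * c n t) \<le> \<rho>"
proof -
  have "(\<Sum>n\<in>A. real n * c n t) \<le> (\<Sum>n. real n * c n t)"
    by (rule sum_le_suminf) (use assms summable_mass mass_term_nonneg in auto)
  then show ?thesis using mass[OF assms(1)] f_nonneg[OF assms(1)] by simp
qed

lemma f_le: "0 \<le> t \<Longrightarrow> f t \<le> \<rho>"
  using suminf_nonneg[OF summable_mass mass_term_nonneg, of t] mass[of t] by simp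

lemma rho_nonneg: "0 \<le> \<rho>"
  using f_nonneg[of 0] f_le[of 0] by simp

lemma rate_nonneg: "0 \<le> t \<Longrightarrow> 0 \<le> rate n t"
  using c_nonneg[of n t] by (cases n) (auto simp: rate_def)

lemma rate_le_mass: "0 \<le> t \<Longrightarrow> rate n t \<le> real n * c n t"
proof (cases n)
  case (Suc k)
  assume "0 \<le> t"
  moreover have "real n powr lam \<le> real n powr 1"
    using Suc lam_le_1 by (intro powr_mono) auto
  ultimately show ?thesis using c_nonneg[of n t] Suc by (simp add: rate_def mult_right_mono)
qed (simp add: rate_def)

lemma rate_le: "0 \<le> t \<Longrightarrow> rate n t \<le> \<rho>"
  using rate_le_mass[of t n] partial_mass_le[of t "{n}"] by simp

lemma c_le_rate:
  assumes "1 \<le> n" "0 \<le> t"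
  shows "c n t \<le> rate n t"
proof -
  have "1 * c n t \<le> real n powr lam * c n t"
    using assms lam_nonneg c_nonneg by (intro mult_right_mono ge_one_powr_ge_zero) auto
  then show ?thesis by (simp add: rate_def)
qed

lemma rate_1: "rate 1 t = c 1 t"
  by (simp add: rate_def)

lemma summable_rate: "0 \<le> t \<Longrightarrow> summable (\<lambda>n. rate n t)"
  by (rule summable_comparison_test'[OF summable_mass]) (auto simp: rate_nonneg rate_le_mass)

lemma total_rate_nonneg: "0 \<le> t \<Longrightarrow> 0 \<le> total_rate t"
  unfolding total_rate_def by (intro suminf_nonneg summable_rate rate_nonneg)

lemma flux_eq: "J n t = \<kappa> * f t * rate n t - rate (Suc n) t"
  by (auto simp: flux_def rate_def a_eq b_eq)

lemma c_deriv_rate: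
  assumes "1 \<le> n" "0 \<le> t"
  shows "(c n has_real_derivative
    rate (Suc n) t - ((1 + \<kappa> * f t) * rate n t - \<kappa> * f t * rate (n - 1) t)) (at t within {0..})"
  using c_deriv[OF assms] assms by (simp add: flux_eq algebra_simps)

text \<open>
  The sums of \<open>rate n t\<close> and of \<open>rate (Suc n) t\<close> agree because \<open>rate 0 t = 0\<close>, so the
  series of fluxes collapses to a multiple of \<open>total_rate\<close>.
\<close>

lemma f_deriv:
  assumes "0 \<le> t"
  shows "(f has_real_derivative (1 - \<kappa> * f t) * total_rate t) (at t within {0..})"
proof -
  have "(\<lambda>n. rate n t) sums total_rate t"
    unfolding total_rate_def using summable_rate[OF assms] by (rule summable_sums)
  moreover from this have "(\<lambda>n. rate (Suc n) t) sums total_rate t"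
    using sums_Suc_iff[of "\<lambda>n. rate n t" "total_rate t"] by (simp add: rate_def)
  ultimately have "(\<lambda>n. J n t) sums (\<kappa> * f t * total_rate t - total_rate t)"
    unfolding flux_eq by (intro sums_diff sums_mult)
  then have "- (\<Sum>n. J n t) = (1 - \<kappa> * f t) * total_rate t"
    by (simp add: sums_unique[symmetric] left_diff_distrib)
  then show ?thesis using f_deriv_flux[OF assms] by simp
qed

lemma excess_deriv:
  assumes "0 \<le> t"
  shows "((\<lambda>t. 1 - \<kappa> * f t) has_real_derivative - (\<kappa> * total_rate t) * (1 - \<kappa> * f t)) (at t within {0..})"
    and "((\<lambda>t. \<kappa> * f t - 1) has_real_derivative - (\<kappa> * total_rate t) * (\<kappa> * f t - 1)) (at t within {0..})"
proof -
  note kf = DERIV_cmult[OF f_deriv[OF assms], of \<kappa>]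
  show "((\<lambda>t. 1 - \<kappa> * f t) has_real_derivative - (\<kappa> * total_rate t) * (1 - \<kappa> * f t)) (at t within {0..})"
    by (rule DERIV_cong[OF DERIV_diff[OF DERIV_const kf]]) (simp add: algebra_simps)
  show "((\<lambda>t. \<kappa> * f t - 1) has_real_derivative - (\<kappa> * total_rate t) * (\<kappa> * f t - 1)) (at t within {0..})"
    by (rule DERIV_cong[OF DERIV_diff[OF kf DERIV_const]]) (simp add: algebra_simps)
qed

lemma rate_lipschitz:
  assumes "1 \<le> n"
  shows "\<exists>L\<ge>0. \<forall>s t. 0 \<le> s \<longrightarrow> s \<le> t \<longrightarrow> \<bar>rate n t - rate n s\<bar> \<le> L * (t - s)"
proof -
  define M where "M = 2 * (1 + \<kappa> * \<rho>) * \<rho>"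
  have M: "0 \<le> M" using kappa_pos rho_nonneg by (simp add: M_def)
  have bound: "\<bar>rate (Suc n) t - ((1 + \<kappa> * f t) * rate n t - \<kappa> * f t * rate (n - 1) t)\<bar> \<le> M"
    if t: "0 \<le> t" for t
  proof -
    have "(1 + \<kappa> * f t) * rate n t \<le> (1 + \<kappa> * \<rho>) * \<rho>" "0 \<le> (1 + \<kappa> * f t) * rate n t"
      "\<kappa> * f t * rate (n - 1) t \<le> \<kappa> * \<rho> * \<rho>" "0 \<le> \<kappa> * f t * rate (n - 1) t"
      using t kappa_pos rho_nonneg f_nonneg[OF t] f_le[OF t] rate_le[OF t] rate_nonneg[OF t]
      by (auto intro!: mult_mono add_mono)
    moreover have "M = (1 + \<kappa> * \<rho>) * \<rho> + \<rho> + \<kappa> * \<rho> * \<rho>" by (simp add: M_def algebra_simps)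
    moreover have "0 \<le> \<kappa> * \<rho> * \<rho>" using kappa_pos rho_nonneg by simp
    ultimately show ?thesis using rate_le[OF t, of "Suc n"] rate_nonneg[OF t, of "Suc n"] rho_nonneg
      by (simp add: abs_le_iff)
  qed
  show ?thesis
  proof (intro exI[of _ "real n powr lam * M"] conjI allI impI)
    show "0 \<le> real n powr lam * M" using M by simp
    fix s t :: real assume "0 \<le> s" "s \<le> t"
    then have "\<bar>c n t - c n s\<bar> \<le> M * (t - s)"
      by (intro half_line_lipschitz[OF c_deriv_rate[OF assms] bound])
    then have "real n powr lam * \<bar>c n t - c n s\<bar> \<le> real n powr lam * (M * (t - s))"
      by (intro mult_left_mono) auto
    then show "\<bar>rate n t - rate n s\<bar> \<le> real n powr lam * M * (t - s)"
      by (simp add: rate_def right_diff_distrib[symmetric] abs_mult)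
  qed
qed

definition flux_bound :: real where
  "flux_bound = (\<kappa> * \<rho> + 1) * \<rho>"

text \<open>
  After summation by parts each flux is multiplied by an increment of \<open>w\<close>. The exponent \<open>1 - lam\<close>
  is the critical one: \<open>n powr (1 - lam) * rate n t = n * c n t\<close>, whose sum is bounded by the mass.
  The boundary term at size one is kept, for it measures the loss of clusters.
\<close>

lemma weighted_flux_bound:
  assumes t: "0 \<le> t" and B: "0 \<le> B"
    and w: "\<And>n. 1 \<le> n \<Longrightarrow> \<bar>w (Suc n) - w n\<bar> \<le> B * real n powr (1 - lam)"
    and end_zero: "w (Suc K) = 0"
  shows "(\<Sum>n=1..K. w n * (J (n - 1) t - J n t)) \<le> B * flux_bound - w 1 * c 1 t"
proof -
  have weight: "real n powr (1 - lam) * rate n t = real n * c n t" if "1 \<le> n" for n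
    using that powr_add[of "real n" "1 - lam" lam] by (simp add: rate_def mult.assoc[symmetric])
  have summand: "(w (Suc n) - w n) * J n t
      \<le> B * (\<kappa> * \<rho> * (real n * c n t) + real (Suc n) * c (Suc n) t)" if n: "1 \<le> n" for n
  proof -
    have "\<bar>J n t\<bar> \<le> \<kappa> * f t * rate n t + rate (Suc n) t"
      unfolding flux_eq using kappa_pos f_nonneg[OF t] rate_nonneg[OF t]
      by (simp add: abs_le_iff)
    also have "\<dots> \<le> \<kappa> * \<rho> * rate n t + rate (Suc n) t"
      using kappa_pos f_le[OF t] rate_nonneg[OF t] by (intro add_right_mono mult_right_mono) auto
    finally have J: "\<bar>J n t\<bar> \<le> \<kappa> * \<rho> * rate n t + rate (Suc n) t" .
    have "(w (Suc n) - w n) * J n t \<le> \<bar>w (Suc n) - w n\<bar> * \<bar>J n t\<bar>"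
      by (metis abs_ge_self abs_mult)
    also have "\<dots> \<le> (B * real n powr (1 - lam)) * (\<kappa> * \<rho> * rate n t + rate (Suc n) t)"
      using B by (intro mult_mono w n J) auto
    also have "\<dots> = B * (\<kappa> * \<rho> * (real n powr (1 - lam) * rate n t) + real n powr (1 - lam) * rate (Suc n) t)"
      by (simp add: algebra_simps)
    also have "\<dots> \<le> B * (\<kappa> * \<rho> * (real n powr (1 - lam) * rate n t)
        + real (Suc n) powr (1 - lam) * rate (Suc n) t)"
      using B lam_le_1 rate_nonneg[OF t] by (intro mult_left_mono add_left_mono mult_right_mono powr_mono2) auto
    finally show ?thesis using n by (simp only: weight)
  qed
  have shift: "(\<Sum>n=1..K. real (Suc n) * c (Suc n) t) = (\<Sum>n\<in>{2..Suc K}. real n * c n t)"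
    by (rule sum.reindex_bij_witness[of _ "\<lambda>n. n - 1" Suc]) auto
  have "(\<Sum>n=1..K. (w (Suc n) - w n) * J n t)
      \<le> (\<Sum>n=1..K. B * (\<kappa> * \<rho> * (real n * c n t) + real (Suc n) * c (Suc n) t))"
    using summand by (intro sum_mono) auto
  also have "\<dots> = B * (\<kappa> * \<rho> * (\<Sum>n=1..K. real n * c n t) + (\<Sum>n\<in>{2..Suc K}. real n * c n t))"
    unfolding sum_distrib_left[symmetric] sum.distrib shift ..
  also have "\<dots> \<le> B * (\<kappa> * \<rho> * \<rho> + \<rho>)"
    using B kappa_pos rho_nonneg by (intro mult_left_mono add_mono partial_mass_le t) auto
  also have "\<dots> = B * flux_bound" by (simp add: flux_bound_def algebra_simps)
  finally show ?thesis
    using summation_by_parts[of w "\<lambda>n. J n t" K] end_zero by (simp add: flux_def)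
qed

text \<open>
  The integrated form of the preceding estimate. The lower bound \<open>p\<close> on \<open>c 1\<close> stands in for the integral of
  \<open>c 1\<close>: it allows passing to the limit in the weights without exchanging limits and integrals.
\<close>

lemma weighted_sum_growth:
  assumes st: "0 \<le> s" "s \<le> t" and B: "0 \<le> B"
    and w: "\<And>n. 1 \<le> n \<Longrightarrow> \<bar>w (Suc n) - w n\<bar> \<le> B * real n powr (1 - lam)"
    and w_end: "w (Suc K) = 0" "0 \<le> w 1"
    and p: "\<And>x. s \<le> x \<Longrightarrow> x \<le> t \<Longrightarrow> p \<le> c 1 x"
  shows "(\<Sum>n=1..K. w n * c n t) - (\<Sum>n=1..K. w n * c n s) \<le> (t - s) * (B * flux_bound - w 1 * p)"
proof (cases "s = t")
  case False
  have deriv: "((\<lambda>t. \<Sum>n=1..K. w n * c n t) has_real_derivative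
      (\<Sum>n=1..K. w n * (J (n - 1) x - J n x))) (at x within {0..})" if "0 \<le> x" for x
    using that by (intro DERIV_sum DERIV_cmult c_deriv) auto
  obtain x where x: "s < x" "x < t" and eq:
    "(\<Sum>n=1..K. w n * c n t) - (\<Sum>n=1..K. w n * c n s)
      = (t - s) * (\<Sum>n=1..K. w n * (J (n - 1) x - J n x))"
    using False st by (elim half_line_mvt[OF deriv, rotated -1]) auto
  have "(\<Sum>n=1..K. w n * (J (n - 1) x - J n x)) \<le> B * flux_bound - w 1 * c 1 x"
    using x st by (intro weighted_flux_bound B w w_end) auto
  also have "\<dots> \<le> B * flux_bound - w 1 * p"
    using p[of x] x w_end by (simp add: mult_left_mono)
  finally show ?thesis unfolding eq using st by (intro mult_left_mono) auto
qed simp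

section \<open>Disappearance of clusters of each fixed size\<close>

definition cluster_number :: "real \<Rightarrow> real" where
  "cluster_number t = (\<Sum>n. c (Suc n) t)"

lemma summable_cluster_number:
  assumes "0 \<le> t"
  shows "summable (\<lambda>n. c (Suc n) t)"
proof (rule summable_comparison_test')
  show "summable (\<lambda>n. real (Suc n) * c (Suc n) t)"
    using summable_mass[OF assms] by (subst summable_Suc_iff)
  show "norm (c (Suc n) t) \<le> real (Suc n) * c (Suc n) t" if "0 \<le> n" for n
    using c_nonneg[of "Suc n" t] assms mult_right_mono[of 1 "real (Suc n)" "c (Suc n) t"] by simp
qed

lemma cluster_number_nonneg: "0 \<le> t \<Longrightarrow> 0 \<le> cluster_number t"
  unfolding cluster_number_def by (intro suminf_nonneg summable_cluster_number c_nonneg) auto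

text \<open>
  The part that the cutoff removes from the first \<open>K\<close> terms is the partial mass divided by \<open>K\<close>,
  hence at most \<open>\<rho> / K\<close>.
\<close>

lemma cutoff_sum_tendsto_cluster_number:
  assumes t: "0 \<le> t"
  shows "(\<lambda>K. \<Sum>n=1..K. cutoff K n * c n t) \<longlonglongrightarrow> cluster_number t"
proof -
  let ?m = "\<lambda>K. \<Sum>n=1..K. real n * c n t"
  have eq: "(\<Sum>n=1..K. cutoff K n * c n t) = (\<Sum>n<K. c (Suc n) t) - ?m K / real K" if "0 < K" for K
  proof -
    have "(\<Sum>n=1..K. cutoff K n * c n t) = (\<Sum>n=1..K. c n t - real n * c n t / real K)"
      using that by (intro sum.cong) (auto simp: cutoff_below algebra_simps)
    also have "\<dots> = (\<Sum>n=1..K. c n t) - ?m K / real K"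
      by (simp add: sum_subtractf sum_divide_distrib)
    also have "(\<Sum>n=1..K. c n t) = (\<Sum>n<K. c (Suc n) t)"
      by (rule sum.reindex_bij_witness[of _ Suc "\<lambda>n. n - 1"]) auto
    finally show ?thesis .
  qed
  have "(\<lambda>K. ?m K / real K) \<longlonglongrightarrow> 0"
  proof (rule tendsto_sandwich[OF _ _ tendsto_const])
    show "\<forall>\<^sub>F K in sequentially. 0 \<le> ?m K / real K"
      using mass_term_nonneg[OF t] by (intro always_eventually allI divide_nonneg_nonneg sum_nonneg) auto
    show "\<forall>\<^sub>F K in sequentially. ?m K / real K \<le> \<rho> / real K"
      using partial_mass_le[OF t] by (intro always_eventually allI divide_right_mono) auto
    show "(\<lambda>K. \<rho> / real K) \<longlonglongrightarrow> 0" by (rule lim_const_over_n)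
  qed
  then have "(\<lambda>K. (\<Sum>n<K. c (Suc n) t) - ?m K / real K) \<longlonglongrightarrow> cluster_number t - 0"
    unfolding cluster_number_def by (intro tendsto_diff summable_LIMSEQ summable_cluster_number t)
  moreover have "\<forall>\<^sub>F K in sequentially.
      (\<Sum>n<K. c (Suc n) t) - ?m K / real K = (\<Sum>n=1..K. cutoff K n * c n t)"
    using eventually_gt_at_top[of 0] by eventually_elim (rule eq[symmetric])
  ultimately show ?thesis by (simp add: Lim_transform_eventually)
qed

text \<open>
  Clusters are created and merged by no reaction; they only disappear from size one.
  With the cutoff as weight the flux error is of order \<open>1 / K\<close> and vanishes in the limit.
\<close>

lemma cluster_number_decrease:
  assumes st: "0 \<le> s" "s \<le> t" and p: "\<And>x. s \<le> x \<Longrightarrow> x \<le> t \<Longrightarrow> p \<le> c 1 x"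
  shows "cluster_number t - cluster_number s \<le> - ((t - s) * p)"
proof (rule LIMSEQ_le)
  show "(\<lambda>K. (\<Sum>n=1..K. cutoff K n * c n t) - (\<Sum>n=1..K. cutoff K n * c n s)) \<longlonglongrightarrow> cluster_number t - cluster_number s"
    using st by (intro tendsto_diff cutoff_sum_tendsto_cluster_number) auto
  have "(\<lambda>K. (t - s) * (1 / real K * flux_bound - (1 - 1 / real K) * p)) \<longlonglongrightarrow> (t - s) * (0 * flux_bound - (1 - 0) * p)"
    by (intro tendsto_intros lim_const_over_n)
  then show "(\<lambda>K. (t - s) * (1 / real K * flux_bound - (1 - 1 / real K) * p)) \<longlonglongrightarrow> - ((t - s) * p)"
    by simp
  have "(\<Sum>n=1..K. cutoff K n * c n t) - (\<Sum>n=1..K. cutoff K n * c n s)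
      \<le> (t - s) * (1 / real K * flux_bound - (1 - 1 / real K) * p)" if K: "1 \<le> K" for K
  proof -
    have step: "\<bar>cutoff K (Suc n) - cutoff K n\<bar> \<le> 1 / real K * real n powr (1 - lam)" if "1 \<le> n" for n
    proof -
      have "1 / real K * 1 \<le> 1 / real K * real n powr (1 - lam)"
        using that lam_le_1 by (intro mult_left_mono ge_one_powr_ge_zero) auto
      then show ?thesis using cutoff_step[of K n] by linarith
    qed
    have "(\<Sum>n=1..K. cutoff K n * c n t) - (\<Sum>n=1..K. cutoff K n * c n s)
        \<le> (t - s) * (1 / real K * flux_bound - cutoff K 1 * p)"
      using K by (intro weighted_sum_growth st step p) (auto simp: cutoff_eq_0 cutoff_bounds)
    then show ?thesis using K by (simp add: cutoff_below)
  qed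
  then show "\<exists>M. \<forall>K\<ge>M. (\<Sum>n=1..K. cutoff K n * c n t) - (\<Sum>n=1..K. cutoff K n * c n s)
      \<le> (t - s) * (1 / real K * flux_bound - (1 - 1 / real K) * p)" by blast
qed

lemma cluster_number_converges: "\<exists>l. (cluster_number \<longlongrightarrow> l) at_top"
proof (rule antimono_bounded_below_converges[OF _ cluster_number_nonneg])
  fix s t :: real assume "0 \<le> s" "s \<le> t"
  then show "cluster_number t \<le> cluster_number s"
    using cluster_number_decrease[of s t 0] c_nonneg[of 1] by simp
qed

text \<open>
  Each time \<open>c 1\<close> is large it stays large for a while, since it is Lipschitz, and uses up a
  fixed amount of the cluster number, which has only finitely much to lose.
\<close>

lemma rate_1_tendsto_0: "(rate 1 \<longlongrightarrow> 0) at_top"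
proof -
  obtain l where lim: "(cluster_number \<longlongrightarrow> l) at_top" using cluster_number_converges by blast
  obtain L where L: "0 \<le> L" and lip: "\<And>s t. 0 \<le> s \<Longrightarrow> s \<le> t \<Longrightarrow> \<bar>rate 1 t - rate 1 s\<bar> \<le> L * (t - s)"
    using rate_lipschitz[OF order_refl] by blast
  show ?thesis
  proof (rule vanishing_from_increments[OF lim rate_nonneg L])
    fix h e :: real assume he: "0 < h" "0 < e"
    show "\<forall>\<^sub>F t in at_top. h * rate 1 t \<le> \<bar>cluster_number (t + h) - cluster_number t\<bar> + h * (L * h + e)"
      using eventually_ge_at_top[of 0]
    proof eventually_elim
      case (elim t)
      have "rate 1 t - L * h \<le> c 1 x" if "t \<le> x" "x \<le> t + h" for x
      proof -
        have "L * (x - t) \<le> L * h" using that L by (intro mult_left_mono) auto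
        then show ?thesis using lip[OF elim that(1)] rate_1[of x] by linarith
      qed
      then have "cluster_number (t + h) - cluster_number t \<le> - ((t + h - t) * (rate 1 t - L * h))"
        using elim he by (intro cluster_number_decrease) auto
      then have "h * rate 1 t \<le> \<bar>cluster_number (t + h) - cluster_number t\<bar> + h * (L * h)"
        by (simp add: algebra_simps)
      moreover have "0 \<le> h * e" using he by simp
      ultimately show ?case by (simp add: distrib_left)
    qed
  qed
qed

lemma c_tendsto_0_of_rate:
  assumes "1 \<le> n" "(rate n \<longlongrightarrow> 0) at_top"
  shows "(c n \<longlongrightarrow> 0) at_top"
proof (rule tendsto_sandwich[OF _ _ tendsto_const assms(2)])
  show "\<forall>\<^sub>F t in at_top. 0 \<le> c n t"
    by (rule eventually_mono[OF eventually_ge_at_top[of 0] c_nonneg[OF assms(1)]])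
  show "\<forall>\<^sub>F t in at_top. c n t \<le> rate n t"
    by (rule eventually_mono[OF eventually_ge_at_top[of 0] c_le_rate[OF assms(1)]])
qed

text \<open>
  \<open>c n\<close> tends to zero, and its derivative is at least \<open>rate (Suc n)\<close> minus a multiple of \<open>rate n\<close>,
  because the inflow from size \<open>n - 1\<close> is nonnegative. A value of \<open>rate (Suc n)\<close> bounded away from
  zero would therefore make \<open>c n\<close> increase by a fixed amount.
\<close>

lemma rate_Suc_tendsto_0:
  assumes n: "1 \<le> n" and prev: "(rate n \<longlongrightarrow> 0) at_top"
  shows "(rate (Suc n) \<longlongrightarrow> 0) at_top"
proof -
  define r where "r t = (1 + \<kappa> * f t) * rate n t - \<kappa> * f t * rate (n - 1) t" for t
  define R where "R t = (1 + \<kappa> * \<rho>) * rate n t" for t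
  have R: "(R \<longlongrightarrow> (1 + \<kappa> * \<rho>) * 0) at_top"
    unfolding R_def by (intro tendsto_intros prev)
  have rR: "r t \<le> R t" if t: "0 \<le> t" for t
  proof -
    have "(1 + \<kappa> * f t) * rate n t \<le> (1 + \<kappa> * \<rho>) * rate n t" "0 \<le> \<kappa> * f t * rate (n - 1) t"
      using t kappa_pos f_nonneg[OF t] f_le[OF t] rate_nonneg[OF t] by (auto intro!: mult_right_mono)
    then show ?thesis by (simp add: r_def R_def)
  qed
  obtain L where L: "0 \<le> L"
    and lip: "\<And>s t. 0 \<le> s \<Longrightarrow> s \<le> t \<Longrightarrow> \<bar>rate (Suc n) t - rate (Suc n) s\<bar> \<le> L * (t - s)"
    using rate_lipschitz[of "Suc n"] by auto
  show ?thesis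
  proof (rule vanishing_from_increments[OF c_tendsto_0_of_rate[OF n prev] rate_nonneg L])
    fix h e :: real assume he: "0 < h" "0 < e"
    have "\<forall>\<^sub>F t in at_top. R t < e" using R he by (intro order_tendstoD) auto
    then obtain T where T: "\<And>t. T \<le> t \<Longrightarrow> R t < e" by (auto simp: eventually_at_top_linorder)
    show "\<forall>\<^sub>F t in at_top. h * rate (Suc n) t \<le> \<bar>c n (t + h) - c n t\<bar> + h * (L * h + e)"
      using eventually_ge_at_top[of "max 0 T"]
    proof eventually_elim
      case (elim t)
      have t: "0 \<le> t" "t < t + h" using elim he by auto
      obtain x where x: "t < x" "x < t + h" and eq: "c n (t + h) - c n t = (t + h - t) * (rate (Suc n) x - r x)"
        unfolding r_def by (rule half_line_mvt[OF c_deriv_rate[OF n] t])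
      have "L * (x - t) \<le> L * h" using x L by (intro mult_left_mono) auto
      then have "rate (Suc n) t - L * h \<le> rate (Suc n) x" using lip[of t x] t x by (simp add: abs_le_iff)
      moreover have "r x < e" using rR[of x] T[of x] t x elim by simp
      ultimately have "rate (Suc n) t \<le> (rate (Suc n) x - r x) + (L * h + e)" by simp
      then have "h * rate (Suc n) t \<le> h * ((rate (Suc n) x - r x) + (L * h + e))"
        using he by (intro mult_left_mono) auto
      also have "\<dots> = (c n (t + h) - c n t) + h * (L * h + e)"
        unfolding eq by (simp add: algebra_simps)
      finally show ?case by linarith
    qed
  qed
qed

lemma rate_tendsto_0: "1 \<le> n \<Longrightarrow> (rate n \<longlongrightarrow> 0) at_top"
  by (induction n rule: dec_induct) (use rate_1_tendsto_0 rate_Suc_tendsto_0 in auto)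

lemma c_tendsto_0: "1 \<le> n \<Longrightarrow> (c n \<longlongrightarrow> 0) at_top"
  by (intro c_tendsto_0_of_rate rate_tendsto_0)

section \<open>Convergence of the monomer concentration\<close>

text \<open>
  The increments of \<open>n powr (2 - lam)\<close> have the critical size \<open>n powr (1 - lam)\<close>, so the mass bounds
  the speed at which this moment grows.
\<close>

lemma moment_growth:
  assumes summable: "summable (\<lambda>n. real n powr (2 - lam) * c n 0)"
  obtains A B where "0 < A" "0 < B"
    "\<And>t m. 0 \<le> t \<Longrightarrow> (\<Sum>n=1..m. real n powr (2 - lam) * c n t) \<le> A + B * t"
proof -
  let ?p = "\<lambda>n. real n powr (2 - lam)"
  define I where "I = (\<Sum>n. ?p n * c n 0)"
  have term_nonneg: "0 \<le> ?p n * c n t" if "0 \<le> t" for n t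
    using c_nonneg[of n t] that by (cases n) auto
  have I: "0 \<le> I" unfolding I_def by (intro suminf_nonneg summable term_nonneg) auto
  have flux_bound: "0 \<le> flux_bound" using kappa_pos rho_nonneg by (simp add: flux_bound_def)
  have bound: "(\<Sum>n=1..m. ?p n * c n t) \<le> (2 * I + 1) + (8 * flux_bound + 1) * t" if t: "0 \<le> t" for t m
  proof (cases "m = 0")
    case True
    then show ?thesis using I flux_bound t by simp
  next
    case False
    \<comment> \<open>A cutoff at twice the range of summation is at least \<open>1 / 2\<close> on that range.\<close>
    define K where "K = 2 * m"
    have K: "0 < K" "m \<le> K" using False by (auto simp: K_def)
    let ?w = "\<lambda>n. ?p n * cutoff K n"
    have "(\<Sum>n=1..m. ?p n * c n t) / 2 = (\<Sum>n=1..m. ?p n * c n t * (1 / 2))"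
      by (simp add: sum_divide_distrib)
    also have "\<dots> \<le> (\<Sum>n=1..m. ?p n * c n t * cutoff K n)"
    proof (intro sum_mono mult_left_mono term_nonneg t)
      fix n assume "n \<in> {1..m}"
      then show "1 / 2 \<le> cutoff K n" by (auto simp: cutoff_def K_def field_simps)
    qed
    also have "\<dots> \<le> (\<Sum>n=1..K. ?p n * c n t * cutoff K n)"
      using K by (intro sum_mono2 mult_nonneg_nonneg term_nonneg t cutoff_bounds) auto
    also have "\<dots> = (\<Sum>n=1..K. ?w n * c n t)" by (simp add: mult_ac)
    also have "\<dots> \<le> (\<Sum>n=1..K. ?w n * c n 0) + (t - 0) * (4 * flux_bound - ?w 1 * 0)"
    proof -
      have "(\<Sum>n=1..K. ?w n * c n t) - (\<Sum>n=1..K. ?w n * c n 0) \<le> (t - 0) * (4 * flux_bound - ?w 1 * 0)"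
        using K t lam_nonneg lam_le_1 c_nonneg[of 1]
        by (intro weighted_sum_growth truncated_power_step) (auto simp: cutoff_eq_0 cutoff_bounds)
      then show ?thesis by linarith
    qed
    also have "(\<Sum>n=1..K. ?w n * c n 0) \<le> (\<Sum>n=1..K. ?p n * c n 0)"
    proof (rule sum_mono)
      fix n
      have "?p n * c n 0 * cutoff K n \<le> ?p n * c n 0 * 1"
        by (intro mult_left_mono cutoff_bounds term_nonneg) auto
      then show "?w n * c n 0 \<le> ?p n * c n 0" by (simp add: mult_ac)
    qed
    also have "\<dots> \<le> I"
      unfolding I_def by (intro sum_le_suminf summable term_nonneg) auto
    finally have "(\<Sum>n=1..m. ?p n * c n t) \<le> 2 * I + 8 * (flux_bound * t)" by (simp add: mult_ac)
    also have "\<dots> \<le> (2 * I + 1) + (8 * flux_bound + 1) * t" using t by (simp add: algebra_simps)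
    finally show ?thesis .
  qed
  show ?thesis by (rule that[OF _ _ bound]) (use I flux_bound in auto)
qed

text \<open>
  Cauchy-Schwarz, with \<open>n\<close> as the geometric mean of \<open>n powr lam\<close> and \<open>n powr (2 - lam)\<close>.
\<close>

lemma mass_interpolation:
  assumes t: "0 \<le> t"
    and moment: "\<And>m. (\<Sum>n=1..m. real n powr (2 - lam) * c n t) \<le> M"
  shows "(\<rho> - f t)\<^sup>2 \<le> total_rate t * M"
proof (rule LIMSEQ_le_const2)
  have "(\<lambda>m. \<Sum>n\<le>m. real n * c n t) \<longlonglongrightarrow> \<rho> - f t"
    using summable_LIMSEQ'[OF summable_mass[OF t]] mass[OF t] by simp
  then show "(\<lambda>m. (\<Sum>n\<le>m. real n * c n t)\<^sup>2) \<longlonglongrightarrow> (\<rho> - f t)\<^sup>2"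
    by (rule tendsto_power)
  have "(\<Sum>n\<le>m. real n * c n t)\<^sup>2 \<le> total_rate t * M" for m
  proof -
    let ?q = "\<lambda>n. real n powr (2 - lam) * c n t"
    have q: "0 \<le> ?q n" for n using c_nonneg[of n t] t by (cases n) auto
    have mass_term: "real n * c n t = sqrt (rate n t) * sqrt (?q n)" for n
    proof (cases "n = 0")
      case False
      have "rate n t * ?q n = (real n powr lam * real n powr (2 - lam)) * (c n t)\<^sup>2"
        by (simp add: rate_def power2_eq_square mult_ac)
      also have "real n powr lam * real n powr (2 - lam) = (real n)\<^sup>2"
        using False by (simp flip: powr_add)
      finally have "sqrt (rate n t * ?q n) = sqrt ((real n * c n t)\<^sup>2)" by (simp add: power_mult_distrib)
      then show ?thesis using mass_term_nonneg[OF t, of n] by (simp add: real_sqrt_mult)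
    qed (simp add: rate_def)
    have "(\<Sum>n\<le>m. real n * c n t)\<^sup>2 \<le> (\<Sum>n\<le>m. (sqrt (rate n t))\<^sup>2) * (\<Sum>n\<le>m. (sqrt (?q n))\<^sup>2)"
      unfolding mass_term by (rule Cauchy_Schwarz_ineq_sum)
    also have "\<dots> = (\<Sum>n\<le>m. rate n t) * (\<Sum>n\<le>m. ?q n)"
      by (simp only: real_sqrt_pow2[OF rate_nonneg[OF t]] real_sqrt_pow2[OF q])
    also have "(\<Sum>n\<le>m. ?q n) = (\<Sum>n=1..m. ?q n)"
      by (rule sum.mono_neutral_right) (auto simp: not_less_eq_eq)
    also have "(\<Sum>n\<le>m. rate n t) * (\<Sum>n=1..m. ?q n) \<le> total_rate t * M"
    proof (rule mult_mono)
      show "(\<Sum>n\<le>m. rate n t) \<le> total_rate t"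
        unfolding total_rate_def by (intro sum_le_suminf summable_rate rate_nonneg t) auto
    qed (use moment total_rate_nonneg[OF t] q in \<open>auto intro: sum_nonneg\<close>)
    finally show ?thesis .
  qed
  then show "\<exists>k. \<forall>m\<ge>k. (\<Sum>n\<le>m. real n * c n t)\<^sup>2 \<le> total_rate t * M" by blast
qed

text \<open>
  A cluster mass bounded below makes \<open>total_rate\<close> at least of order \<open>1 / t\<close>, which suffices for
  \<open>1 - \<kappa> f\<close> to decay, whichever sign it has.
\<close>

lemma excess_decays:
  assumes moment0: "summable (\<lambda>n. real n powr (2 - lam) * c n 0)"
    and m: "0 < m" "\<And>t. 0 \<le> t \<Longrightarrow> m \<le> \<rho> - f t"
  shows "(f \<longlongrightarrow> 1 / \<kappa>) at_top"
proof -
  obtain A B where AB: "0 < A" "0 < B"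
    and moment: "\<And>t k. 0 \<le> t \<Longrightarrow> (\<Sum>n=1..k. real n powr (2 - lam) * c n t) \<le> A + B * t"
    by (rule moment_growth[OF moment0]) (rule that)
  have q: "0 < \<kappa> * m\<^sup>2" using kappa_pos m by simp
  have rate: "\<kappa> * m\<^sup>2 \<le> \<kappa> * total_rate t * (A + B * t)" if t: "0 \<le> t" for t
  proof -
    have "m\<^sup>2 \<le> (\<rho> - f t)\<^sup>2" using m(2)[OF t] m(1) by (intro power_mono) auto
    also have "\<dots> \<le> total_rate t * (A + B * t)" by (intro mass_interpolation t moment)
    finally show ?thesis using kappa_pos by (simp add: mult.assoc)
  qed
  have "((\<lambda>t. 1 - \<kappa> * f t) \<longlongrightarrow> 0) at_top"
  proof (cases "0 \<le> 1 - \<kappa> * f 0")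
    case True
    then show ?thesis by (intro damped_decay[OF excess_deriv(1) q AB rate])
  next
    case False
    then have "((\<lambda>t. \<kappa> * f t - 1) \<longlongrightarrow> 0) at_top"
      by (intro damped_decay[OF excess_deriv(2) q AB rate]) auto
    from tendsto_minus[OF this] show ?thesis by simp
  qed
  then have "((\<lambda>t. (1 - (1 - \<kappa> * f t)) / \<kappa>) \<longlongrightarrow> (1 - 0) / \<kappa>) at_top"
    using kappa_pos by (intro tendsto_intros) auto
  then show ?thesis using kappa_pos by simp
qed

text \<open>
  If \<open>f\<close> starts at or above \<open>1 / \<kappa>\<close> it decreases, and the cluster mass never falls below its initial
  positive value. If it starts below, it increases and stays below \<open>1 / \<kappa>\<close>; then either some
  cluster mass is left, and \<open>f\<close> reaches \<open>1 / \<kappa>\<close> in the limit, or all of it is consumed,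
  and \<open>f\<close> tends to \<open>\<rho>\<close>.
\<close>

lemma f_tendsto:
  assumes moment0: "summable (\<lambda>n. real n powr (2 - lam) * c n 0)"
    and f0: "f 0 < \<rho>"
  shows "(f \<longlongrightarrow> min \<rho> (1 / \<kappa>)) at_top"
proof -
  have kS: "0 \<le> \<kappa> * total_rate t" if "0 \<le> t" for t using kappa_pos total_rate_nonneg[OF that] by simp
  show ?thesis
  proof (cases "1 / \<kappa> \<le> f 0")
    case True
    then have start: "0 \<le> \<kappa> * f 0 - 1" using kappa_pos by (simp add: field_simps)
    have "f t \<le> f 0" if "0 \<le> t" for t
      using damped_antimono[OF excess_deriv(2) kS start order_refl that] kappa_pos by simp
    then have "(f \<longlongrightarrow> 1 / \<kappa>) at_top"
      using f0 by (intro excess_decays[OF moment0, of "\<rho> - f 0"]) auto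
    then show ?thesis using True f0 by (simp add: min_def)
  next
    case False
    then have start: "0 \<le> 1 - \<kappa> * f 0" using kappa_pos by (simp add: field_simps)
    have le: "f t \<le> 1 / \<kappa>" if "0 \<le> t" for t
      using damped_sign[OF excess_deriv(1) kS start that] kappa_pos by (simp add: field_simps)
    have mono: "f s \<le> f t" if "0 \<le> s" "s \<le> t" for s t
      using damped_antimono[OF excess_deriv(1) kS start that] kappa_pos by simp
    show ?thesis
    proof (cases "\<exists>m>0. \<forall>t\<ge>0. m \<le> \<rho> - f t")
      case True
      then have lim: "(f \<longlongrightarrow> 1 / \<kappa>) at_top" using excess_decays[OF moment0] by blast
      have "1 / \<kappa> \<le> \<rho>"
        by (rule tendsto_upperbound[OF lim eventually_mono[OF eventually_ge_at_top[of 0] f_le]]) auto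
      then show ?thesis using lim by (simp add: min_def)
    next
      case False
      have lim: "(f \<longlongrightarrow> \<rho>) at_top"
      proof (rule increasing_tendsto)
        show "\<forall>\<^sub>F t in at_top. f t \<le> \<rho>"
          by (rule eventually_mono[OF eventually_ge_at_top[of 0] f_le])
        fix x assume "x < \<rho>"
        then obtain s where s: "0 \<le> s" "\<not> \<rho> - x \<le> \<rho> - f s"
          using False by (meson diff_gt_0_iff_gt)
        show "\<forall>\<^sub>F t in at_top. x < f t"
          using eventually_ge_at_top[of s]
        proof eventually_elim
          case (elim t)
          with s show ?case using mono[of s t] by linarith
        qed
      qed
      have "\<rho> \<le> 1 / \<kappa>"
        by (rule tendsto_upperbound[OF lim eventually_mono[OF eventually_ge_at_top[of 0] le]]) auto
      then show ?thesis using lim by (simp add: min_def)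
    qed
  qed
qed

end

theorem proposition2:
  fixes \<kappa> lam \<rho> :: real
    and a b :: "nat \<Rightarrow> real"
    and f :: "real \<Rightarrow> real"
    and c :: "nat \<Rightarrow> real \<Rightarrow> real"
  assumes "\<kappa> > 0"
    and "0 \<le> lam" and "lam \<le> 1"
    and "\<And>n. n \<ge> 1 \<Longrightarrow> a n = real n powr lam"
    and "\<And>n. n \<ge> 1 \<Longrightarrow> b n = real n powr lam"
    and "is_solution \<kappa> a b \<rho> f c"
    and "summable (\<lambda>n. real n * c n 0)"
    and "\<rho> = f 0 + (\<Sum>n. real n * c n 0)"
    and "f 0 < \<rho>"
  shows "(\<forall>n\<ge>1. (c n \<longlongrightarrow> 0) at_top) \<and>
         (summable (\<lambda>n. real n powr (2 - lam) * c n 0) \<longrightarrow>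
            (f \<longlongrightarrow> min \<rho> (1 / \<kappa>)) at_top)"
proof -
  interpret power_law_solution \<kappa> lam \<rho> a b f c
    by unfold_locales (fact assms)+
  show ?thesis using c_tendsto_0 f_tendsto \<open>f 0 < \<rho>\<close> by blast
qed

end
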